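(* Let $A,B\subseteq\mathbb{N}$ be infinite r.e. sets. If $A$ and $B$ are type-2 uniform, then $A$ and $B$ belong to the same Turing-reducibility equivalence class, i.e. $A\equiv_T B$.
   Context: $\mathbb{N}=\{1,2,3,\dots\}$. A listing of an infinite r.e. set $A\subseteq\mathbb{N}$ is a total computable bijection $h:\mathbb{N}\to A$. Two listings $h,g$ are uniform, $h\sim g$, if $h(i)<h(j)\Leftrightarrow g(i)<g(j)$ for all $i,j\in\mathbb{N}$. Two infinite r.e. sets $A,B$ are uniform, $A\sim B$, if there exist a listing $h$ of $A$ and a listing $g$ of $B$ with $h\sim g$. Two sets $A,A'$ are almost equal, $A\approx A'$, if $(A-A')\cup(A'-A)$ is finite. Two sets $A,B$ are type-2 uniform, $A\sim_2 B$, if there exist sets $A',B'$ with $A\approx A'$, $B\approx B'$ and $A'\sim B'$. *)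

theory Defs
  imports Main
begin

text \<open>
  An \<open>n\<close>-ary partial function on the natural numbers is represented by a function of type
  \<open>nat list \<Rightarrow> nat option\<close>, of which only the values at lists of length \<open>n\<close> are meaningful.
\<close>

type_synonym pfun = "nat list \<Rightarrow> nat option"

definition pf_comp :: "pfun \<Rightarrow> pfun list \<Rightarrow> pfun" where
  "pf_comp f gs xs = Option.bind (those (map (\<lambda>g. g xs) gs)) f"

text \<open>
  The recursion variable is the first argument; the step function receives the counter,
  the previous value and the parameters, in this order.
\<close>

definition pf_primrec :: "pfun \<Rightarrow> pfun \<Rightarrow> pfun" where
  "pf_primrec f g xs =
     rec_nat (f (tl xs)) (\<lambda>y r. Option.bind r (\<lambda>v. g (y # v # tl xs))) (hd xs)"

text \<open>
  Minimization in the sense of Kleene: the search diverges if it meets an undefined value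
  before the first zero.
\<close>

definition pf_mu :: "pfun \<Rightarrow> pfun" where
  "pf_mu f xs =
     (if \<exists>y. f (y # xs) = Some 0 \<and> (\<forall>z<y. f (z # xs) \<noteq> None)
      then Some (LEAST y. f (y # xs) = Some 0) else None)"

text \<open>
  \<open>partrec_in G n f\<close>: the \<open>n\<close>-ary partial function \<open>f\<close> is partial recursive relative to the
  oracle functions in \<open>G\<close>, each given with its arity.  For \<open>G = {}\<close> these are the ordinary
  partial recursive functions.
\<close>

inductive partrec_in :: "(nat \<times> pfun) set \<Rightarrow> nat \<Rightarrow> pfun \<Rightarrow> bool"
  for G :: "(nat \<times> pfun) set" where
  zero: "partrec_in G n (\<lambda>xs. Some 0)"
| succ: "partrec_in G 1 (\<lambda>xs. Some (Suc (hd xs)))"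
| proj: "i < n \<Longrightarrow> partrec_in G n (\<lambda>xs. Some (xs ! i))"
| oracle_fun: "(n, f) \<in> G \<Longrightarrow> partrec_in G n f"
| comp: "partrec_in G (length gs) f \<Longrightarrow> (\<forall>g\<in>set gs. partrec_in G n g) \<Longrightarrow>
    partrec_in G n (pf_comp f gs)"
| prim_rec: "partrec_in G n f \<Longrightarrow> partrec_in G (n + 2) g \<Longrightarrow>
    partrec_in G (n + 1) (pf_primrec f g)"
| mu: "partrec_in G (n + 1) f \<Longrightarrow> partrec_in G n (pf_mu f)"

text \<open>
  \<open>computable_on G D h\<close>: some partial function that is recursive relative to \<open>G\<close> is defined on
  all of \<open>D\<close> and agrees with \<open>h\<close> there.
\<close>

definition computable_on :: "(nat \<times> pfun) set \<Rightarrow> nat set \<Rightarrow> (nat \<Rightarrow> nat) \<Rightarrow> bool" where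
  "computable_on G D h \<longleftrightarrow> (\<exists>f. partrec_in G 1 f \<and> (\<forall>n\<in>D. f [n] = Some (h n)))"

definition re :: "nat set \<Rightarrow> bool" where
  "re A \<longleftrightarrow> (\<exists>f. partrec_in {} 1 f \<and> A = {n. f [n] \<noteq> None})"

definition char_fun :: "nat set \<Rightarrow> nat \<Rightarrow> nat" where
  "char_fun A n = (if n \<in> A then 1 else 0)"

definition turing_le :: "nat set \<Rightarrow> nat set \<Rightarrow> bool" (infix "\<le>\<^sub>T" 50) where
  "A \<le>\<^sub>T B \<longleftrightarrow> computable_on {(1, \<lambda>xs. Some (char_fun B (hd xs)))} UNIV (char_fun A)"

definition turing_equiv :: "nat set \<Rightarrow> nat set \<Rightarrow> bool" (infix "\<equiv>\<^sub>T" 50) where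
  "A \<equiv>\<^sub>T B \<longleftrightarrow> A \<le>\<^sub>T B \<and> B \<le>\<^sub>T A"

text \<open>
  In what follows the natural numbers start at 1: sets are subsets of \<open>{1..}\<close> and listings have
  domain \<open>{1..}\<close>, so the value of a listing at 0 is irrelevant.
\<close>

definition infinite_re :: "nat set \<Rightarrow> bool" where
  "infinite_re A \<longleftrightarrow> A \<subseteq> {1..} \<and> infinite A \<and> re A"

definition listing :: "(nat \<Rightarrow> nat) \<Rightarrow> nat set \<Rightarrow> bool" where
  "listing h A \<longleftrightarrow> infinite_re A \<and> bij_betw h {1..} A \<and> computable_on {} {1..} h"

definition uniform_listings :: "(nat \<Rightarrow> nat) \<Rightarrow> (nat \<Rightarrow> nat) \<Rightarrow> bool" where
  "uniform_listings h g \<longleftrightarrow> (\<forall>i\<in>{1..}. \<forall>j\<in>{1..}. h i < h j \<longleftrightarrow> g i < g j)"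

definition uniform :: "nat set \<Rightarrow> nat set \<Rightarrow> bool" where
  "uniform A B \<longleftrightarrow> (\<exists>h g. listing h A \<and> listing g B \<and> uniform_listings h g)"

definition almost_equal :: "nat set \<Rightarrow> nat set \<Rightarrow> bool" where
  "almost_equal A A' \<longleftrightarrow> finite ((A - A') \<union> (A' - A))"

definition type2_uniform :: "nat set \<Rightarrow> nat set \<Rightarrow> bool" where
  "type2_uniform A B \<longleftrightarrow>
     (\<exists>A' B'. almost_equal A A' \<and> almost_equal B B' \<and> uniform A' B')"

end

theory Submission
  imports Defs
begin

text \<open>
  If \<open>h\<close> and \<open>g\<close> are uniform listings of \<open>A\<close> and \<open>B\<close>, then \<open>g i \<mapsto> h i\<close> is an order isomorphism
  \<open>\<phi>\<close> from \<open>B\<close> onto \<open>A\<close>, and \<open>\<phi> y\<close> is found for \<open>y \<in> B\<close> by searching for the index \<open>j\<close> with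
  \<open>g j = y\<close>.  With an oracle for \<open>B\<close> one can therefore search for the least \<open>y \<in> B\<close> such that
  \<open>\<phi> y \<ge> n\<close>, and \<open>n \<in> A\<close> holds iff \<open>\<phi> y = n\<close> for this \<open>y\<close>.  Finite modifications of \<open>A\<close> and
  \<open>B\<close> do not change their degrees.
\<close>

section \<open>Total functions recursive in an oracle\<close>

text \<open>Only lists of length \<open>n\<close> are compared, since values elsewhere carry no
  meaning. Plain \<open>nat\<close> values spare the closure proofs the option type.\<close>

definition total_rec_in :: "(nat \<times> pfun) set \<Rightarrow> nat \<Rightarrow> (nat list \<Rightarrow> nat) \<Rightarrow> bool" where
  "total_rec_in G n F \<longleftrightarrow>
     (\<exists>f. partrec_in G n f \<and> (\<forall>xs. length xs = n \<longrightarrow> f xs = Some (F xs)))"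

lemma total_rec_in_cong:
  assumes "total_rec_in G n F" and "\<And>xs. length xs = n \<Longrightarrow> F xs = F' xs"
  shows "total_rec_in G n F'"
  using assms by (auto simp: total_rec_in_def)

lemma total_rec_in_zero: "total_rec_in G n (\<lambda>xs. 0)"
  unfolding total_rec_in_def using partrec_in.zero by blast

lemma total_rec_in_succ: "total_rec_in G 1 (\<lambda>xs. Suc (hd xs))"
  unfolding total_rec_in_def using partrec_in.succ by blast

lemma total_rec_in_proj: "i < n \<Longrightarrow> total_rec_in G n (\<lambda>xs. xs ! i)"
  unfolding total_rec_in_def using partrec_in.proj by blast

lemma total_rec_in_comp1:
  assumes "total_rec_in G 1 (\<lambda>xs. f (hd xs))" and "total_rec_in G n F"
  shows "total_rec_in G n (\<lambda>xs. f (F xs))"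
proof -
  obtain p q where p: "partrec_in G 1 p" "\<And>xs. length xs = 1 \<Longrightarrow> p xs = Some (f (hd xs))"
    and q: "partrec_in G n q" "\<And>xs. length xs = n \<Longrightarrow> q xs = Some (F xs)"
    using assms unfolding total_rec_in_def by blast
  have "partrec_in G n (pf_comp p [q])"
    using p(1) q(1) by (intro partrec_in.comp) auto
  moreover have "pf_comp p [q] xs = Some (f (F xs))" if "length xs = n" for xs
    using that by (simp add: pf_comp_def p(2) q(2))
  ultimately show ?thesis unfolding total_rec_in_def by blast
qed

lemma total_rec_in_comp2:
  assumes "total_rec_in G 2 (\<lambda>xs. f (xs ! 0) (xs ! 1))"
    and "total_rec_in G n F1" and "total_rec_in G n F2"
  shows "total_rec_in G n (\<lambda>xs. f (F1 xs) (F2 xs))"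
proof -
  obtain p q1 q2
    where p: "partrec_in G 2 p" "\<And>xs. length xs = 2 \<Longrightarrow> p xs = Some (f (xs ! 0) (xs ! 1))"
      and q1: "partrec_in G n q1" "\<And>xs. length xs = n \<Longrightarrow> q1 xs = Some (F1 xs)"
      and q2: "partrec_in G n q2" "\<And>xs. length xs = n \<Longrightarrow> q2 xs = Some (F2 xs)"
    using assms unfolding total_rec_in_def by blast
  have "partrec_in G n (pf_comp p [q1, q2])"
    using p(1) q1(1) q2(1) by (intro partrec_in.comp) (auto simp: numeral_2_eq_2)
  moreover have "pf_comp p [q1, q2] xs = Some (f (F1 xs) (F2 xs))" if "length xs = n" for xs
    using that by (simp add: pf_comp_def p(2) q1(2) q2(2))
  ultimately show ?thesis unfolding total_rec_in_def by blast
qed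

lemma total_rec_in_prim_rec:
  assumes "total_rec_in G n F" and "total_rec_in G (n + 2) H"
  shows "total_rec_in G (n + 1)
           (\<lambda>xs. rec_nat (F (tl xs)) (\<lambda>y r. H (y # r # tl xs)) (hd xs))"
proof -
  obtain p q where p: "partrec_in G n p" "\<And>xs. length xs = n \<Longrightarrow> p xs = Some (F xs)"
    and q: "partrec_in G (n + 2) q" "\<And>xs. length xs = n + 2 \<Longrightarrow> q xs = Some (H xs)"
    using assms unfolding total_rec_in_def by blast
  have "pf_primrec p q xs = Some (rec_nat (F (tl xs)) (\<lambda>y r. H (y # r # tl xs)) (hd xs))"
    if "length xs = n + 1" for xs
  proof -
    have "rec_nat (p (tl xs)) (\<lambda>y r. Option.bind r (\<lambda>v. q (y # v # tl xs))) k =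
        Some (rec_nat (F (tl xs)) (\<lambda>y r. H (y # r # tl xs)) k)" for k
      using that by (induction k) (simp_all add: p(2) q(2))
    then show ?thesis by (simp add: pf_primrec_def)
  qed
  then show ?thesis
    unfolding total_rec_in_def using partrec_in.prim_rec[OF p(1) q(1)] by blast
qed

text \<open>As \<open>f\<close> is total, no undefined value can block the search of
  \<open>pf_mu\<close>, and \<open>ex\<close> supplies a zero.\<close>

lemma total_rec_in_Least:
  assumes "total_rec_in G 2 (\<lambda>xs. f (xs ! 0) (xs ! 1))" and ex: "\<And>x. \<exists>y. f y x = 0"
  shows "total_rec_in G 1 (\<lambda>xs. LEAST y. f y (hd xs) = 0)"
proof -
  obtain p where p: "partrec_in G 2 p" "\<And>xs. length xs = 2 \<Longrightarrow> p xs = Some (f (xs ! 0) (xs ! 1))"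
    using assms(1) unfolding total_rec_in_def by blast
  have "partrec_in G 1 (pf_mu p)"
    using p(1) by (intro partrec_in.mu) (simp add: numeral_2_eq_2)
  moreover have "pf_mu p xs = Some (LEAST y. f y (hd xs) = 0)" if "length xs = 1" for xs
  proof -
    have "p (y # xs) = Some (f y (hd xs))" for y
      using that by (cases xs) (simp_all add: p(2))
    then show ?thesis using ex by (simp add: pf_mu_def)
  qed
  ultimately show ?thesis unfolding total_rec_in_def by blast
qed

section \<open>Closure under truncated arithmetic\<close>

lemma total_rec_in_Suc:
  "total_rec_in G n F \<Longrightarrow> total_rec_in G n (\<lambda>xs. Suc (F xs))"
  by (rule total_rec_in_comp1[OF total_rec_in_succ])

lemma total_rec_in_const: "total_rec_in G n (\<lambda>xs. k)"
  by (induction k) (auto intro: total_rec_in_zero total_rec_in_Suc)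

lemma total_rec_in_add:
  assumes "total_rec_in G n F1" and "total_rec_in G n F2"
  shows "total_rec_in G n (\<lambda>xs. F1 xs + F2 xs)"
proof (rule total_rec_in_comp2[OF _ assms])
  have "rec_nat b (\<lambda>y. Suc) a = a + b" for a b
    by (induction a) auto
  moreover have "total_rec_in G (1 + 1)
      (\<lambda>xs. rec_nat (tl xs ! 0) (\<lambda>y r. Suc ((y # r # tl xs) ! 1)) (hd xs))"
    by (intro total_rec_in_prim_rec total_rec_in_Suc total_rec_in_proj) auto
  ultimately show "total_rec_in G 2 (\<lambda>xs. xs ! 0 + xs ! 1)"
    unfolding one_add_one by (elim total_rec_in_cong) (auto simp: numeral_2_eq_2 length_Suc_conv)
qed

lemma total_rec_in_pred:
  assumes "total_rec_in G n F"
  shows "total_rec_in G n (\<lambda>xs. F xs - 1)"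
proof (rule total_rec_in_comp1[OF _ assms])
  \<comment> \<open>In the last step the counter already is the predecessor, so the step function
    returns it and drops the previous value.\<close>
  have "rec_nat 0 (\<lambda>y r. y) a = a - 1" for a :: nat
    by (cases a) auto
  then show "total_rec_in G 1 (\<lambda>xs. hd xs - 1)"
    using total_rec_in_prim_rec[OF total_rec_in_zero[of G 0] total_rec_in_proj[of 0 "0 + 2"]]
    by simp
qed

lemma total_rec_in_diff:
  assumes "total_rec_in G n F1" and "total_rec_in G n F2"
  shows "total_rec_in G n (\<lambda>xs. F1 xs - F2 xs)"
\<comment> \<open>Subtraction recurses on the subtrahend, but \<open>pf_primrec\<close> on the first
  argument; hence the swapped \<open>f\<close>.\<close>
proof (rule total_rec_in_comp2[OF _ assms(2,1), where f = "\<lambda>a b. b - a"])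
  have "rec_nat b (\<lambda>y r. r - Suc 0) a = b - a" for a b :: nat
    by (induction a) auto
  moreover have "total_rec_in G (1 + 1)
      (\<lambda>xs. rec_nat (tl xs ! 0) (\<lambda>y r. (y # r # tl xs) ! 1 - 1) (hd xs))"
    by (intro total_rec_in_prim_rec total_rec_in_pred total_rec_in_proj) auto
  ultimately show "total_rec_in G 2 (\<lambda>xs. xs ! 1 - xs ! 0)"
    unfolding one_add_one by (elim total_rec_in_cong) (auto simp: numeral_2_eq_2 length_Suc_conv)
qed

text \<open>The absolute difference: one summand is always 0. It turns equality into the vanishing
  of a recursive function.\<close>

definition nat_dist :: "nat \<Rightarrow> nat \<Rightarrow> nat" where
  "nat_dist a b = (a - b) + (b - a)"

lemma nat_dist_eq_0_iff [simp]: "nat_dist a b = 0 \<longleftrightarrow> a = b"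
  by (auto simp: nat_dist_def)

lemma nat_dist_self [simp]: "nat_dist a a = 0"
  by simp

lemma total_rec_in_nat_dist:
  assumes "total_rec_in G n F1" and "total_rec_in G n F2"
  shows "total_rec_in G n (\<lambda>xs. nat_dist (F1 xs) (F2 xs))"
  unfolding nat_dist_def by (intro total_rec_in_add total_rec_in_diff assms)

section \<open>Passing to a larger oracle\<close>

lemma partrec_in_mono:
  assumes "partrec_in G n f" and "G \<subseteq> H"
  shows "partrec_in H n f"
  using assms
proof (induction rule: partrec_in.induct)
  case succ
  show ?case by (rule partrec_in.succ)
next
  case prim_rec
  then show ?case by (intro partrec_in.prim_rec) auto
qed (auto intro: partrec_in.intros)

text \<open>Makes listings, which are computed without an oracle, available relative to any
  \<open>G\<close>.\<close>

lemma total_rec_in_mono: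
  "total_rec_in G n F \<Longrightarrow> G \<subseteq> H \<Longrightarrow> total_rec_in H n F"
  unfolding total_rec_in_def using partrec_in_mono by blast

lemma computable_on_UNIV_iff:
  "computable_on G UNIV h \<longleftrightarrow> total_rec_in G 1 (\<lambda>xs. h (hd xs))"
  unfolding computable_on_def total_rec_in_def
  by (auto simp: length_Suc_conv)

section \<open>Sets decidable in an oracle\<close>

text \<open>\<open>G\<close> stays arbitrary so that decidability can be carried from set to set
  relative to one fixed oracle.\<close>

definition decidable_in :: "(nat \<times> pfun) set \<Rightarrow> nat set \<Rightarrow> bool" where
  "decidable_in G A \<longleftrightarrow> total_rec_in G 1 (\<lambda>xs. char_fun A (hd xs))"

lemma turing_le_iff:
  "A \<le>\<^sub>T B \<longleftrightarrow> decidable_in {(1, \<lambda>xs. Some (char_fun B (hd xs)))} A"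
  by (simp add: turing_le_def computable_on_UNIV_iff decidable_in_def)

lemma turing_le_refl: "A \<le>\<^sub>T A"
  unfolding turing_le_def computable_on_def by (auto intro: partrec_in.oracle_fun)

lemma total_rec_in_hd: "total_rec_in G 1 hd"
  by (rule total_rec_in_cong[OF total_rec_in_proj[of 0]]) (auto simp: length_Suc_conv)

lemma decidable_in_Compl:
  assumes "decidable_in G A"
  shows "decidable_in G (- A)"
proof -
  have "total_rec_in G 1 (\<lambda>xs. 1 - char_fun A (hd xs))"
    using assms unfolding decidable_in_def by (intro total_rec_in_diff total_rec_in_const)
  then show ?thesis
    unfolding decidable_in_def by (rule total_rec_in_cong) (simp add: char_fun_def)
qed

lemma decidable_in_Un:
  assumes "decidable_in G A" and "decidable_in G B"
  shows "decidable_in G (A \<union> B)"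
proof -
  \<comment> \<open>The sum may be 2; the double truncated complement cuts it down to 1.\<close>
  have "total_rec_in G 1 (\<lambda>xs. 1 - (1 - (char_fun A (hd xs) + char_fun B (hd xs))))"
    using assms unfolding decidable_in_def
    by (intro total_rec_in_diff total_rec_in_add total_rec_in_const)
  then show ?thesis
    unfolding decidable_in_def by (rule total_rec_in_cong) (simp add: char_fun_def)
qed

lemma decidable_in_equality:
  assumes "total_rec_in G 1 (\<lambda>xs. f (hd xs))" and "total_rec_in G 1 (\<lambda>xs. g (hd xs))"
  shows "decidable_in G {n. f n = g n}"
proof -
  have "total_rec_in G 1 (\<lambda>xs. 1 - nat_dist (f (hd xs)) (g (hd xs)))"
    by (intro total_rec_in_diff total_rec_in_nat_dist total_rec_in_const assms)
  then show ?thesis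
    unfolding decidable_in_def
    by (rule total_rec_in_cong)
       (auto simp: char_fun_def Suc_le_eq simp flip: neq0_conv)
qed

lemma decidable_in_finite:
  assumes "finite A"
  shows "decidable_in G A"
  using assms
proof induction
  case empty
  then show ?case by (simp add: decidable_in_def char_fun_def total_rec_in_zero)
next
  case (insert a A)
  have "decidable_in G {n. n = a}"
    using decidable_in_equality[of G "\<lambda>n. n" "\<lambda>n. a"] total_rec_in_hd total_rec_in_const by simp
  from decidable_in_Un[OF this insert.IH] show ?case by simp
qed

section \<open>Finite modifications\<close>

lemma almost_equal_sym: "almost_equal A B \<Longrightarrow> almost_equal B A"
  by (simp add: almost_equal_def Un_commute)

lemma decidable_in_almost_equal:
  assumes "almost_equal A A'" and "decidable_in G A'"
  shows "decidable_in G A"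
proof -
  have "decidable_in G (A - A')" "decidable_in G (A' - A)"
    using assms(1) by (auto simp: almost_equal_def intro: decidable_in_finite)
  \<comment> \<open>\<open>A'\<close> with the finite set \<open>A - A'\<close> added and the finite
    set \<open>A' - A\<close> removed, written with union and complement only.\<close>
  moreover have "A = - (- (A' \<union> (A - A')) \<union> (A' - A))"
    by auto
  ultimately show ?thesis
    using assms(2) by (metis decidable_in_Compl decidable_in_Un)
qed

section \<open>Uniform listings\<close>

text \<open>As \<open>g i \<mapsto> h i\<close> preserves order, the least \<open>y\<close> in
  \<open>range g\<close> with image at least \<open>n\<close> is sent to the least element of
  \<open>range h\<close> that is at least \<open>n\<close>; this is \<open>n\<close> itself iff
  \<open>n\<close> lies in \<open>range h\<close>. By \<open>inf\<close> such a \<open>y\<close>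
  exists.\<close>

lemma decidable_in_range_uniform:
  assumes h: "total_rec_in G 1 (\<lambda>xs. h (hd xs))" and g: "total_rec_in G 1 (\<lambda>xs. g (hd xs))"
    and less_iff: "\<And>i j. h i < h j \<longleftrightarrow> g i < g j"
    and inf: "infinite (range h)" and dec: "decidable_in G (range g)"
  shows "decidable_in G (range h)"
proof -
  define c where "c = char_fun (range g)"
  have c: "total_rec_in G 1 (\<lambda>xs. c (hd xs))"
    using dec by (simp add: c_def decidable_in_def)
  \<comment> \<open>The truncated difference vanishes iff \<open>y \<in> range g\<close> implies \<open>g j = y\<close>, so that the search
      terminates for all \<open>y\<close>.\<close>
  define idx where "idx y = (LEAST j. c y - (1 - nat_dist (g j) y) = 0)" for y
  have ex_idx: "\<exists>j. c y - (1 - nat_dist (g j) y) = 0" for y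
  proof (cases "y \<in> range g")
    case True
    then obtain i where "y = g i" by blast
    then show ?thesis by (intro exI[of _ i]) (simp add: c_def char_fun_def)
  qed (simp add: c_def char_fun_def)
  have idx: "total_rec_in G 1 (\<lambda>xs. idx (hd xs))"
    unfolding idx_def
    by (intro total_rec_in_Least ex_idx total_rec_in_diff total_rec_in_const total_rec_in_nat_dist
        total_rec_in_comp1[OF c] total_rec_in_comp1[OF g] total_rec_in_proj) auto
  have h_idx: "h (idx (g i)) = h i" for i
  proof -
    have "c (g i) - (1 - nat_dist (g (idx (g i))) (g i)) = 0"
      unfolding idx_def by (rule LeastI_ex[OF ex_idx])
    then have "nat_dist (g (idx (g i))) (g i) = 0"
      by (simp add: c_def char_fun_def del: nat_dist_eq_0_iff)
    then have "g (idx (g i)) = g i" by simp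
    \<comment> \<open>Equal \<open>g\<close>-values force equal \<open>h\<close>-values: by
      \<open>less_iff\<close> neither \<open>h\<close>-value is below the other.\<close>
    then show ?thesis by (metis less_iff linorder_neqE_nat less_irrefl)
  qed
  \<comment> \<open>A sum of naturals vanishes iff both summands do. The second one rejects
    \<open>y\<close> outside \<open>range g\<close>, where \<open>idx y\<close> is only the default
    0.\<close>
  define P where "P n y \<longleftrightarrow> (n - h (idx y)) + (1 - c y) = 0" for n y
  have P_iff: "P n y \<longleftrightarrow> y \<in> range g \<and> n \<le> h (idx y)" for n y
    by (auto simp: P_def c_def char_fun_def)
  have ex_P: "\<exists>y. P n y" for n
  proof -
    obtain i where "n \<le> h i"
      using inf unfolding finite_nat_set_iff_bounded by (auto simp: not_less)
    then have "P n (g i)" by (simp add: P_iff h_idx)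
    then show ?thesis ..
  qed
  define m where "m n = (LEAST y. P n y)" for n
  have "total_rec_in G 1 (\<lambda>xs. m (hd xs))"
    unfolding m_def P_def
    by (intro total_rec_in_Least ex_P[unfolded P_def] total_rec_in_add total_rec_in_diff
        total_rec_in_const total_rec_in_comp1[OF c] total_rec_in_comp1[OF h]
        total_rec_in_comp1[OF idx] total_rec_in_proj) auto
  then have "decidable_in G {n. h (idx (m n)) = n}"
    by (intro decidable_in_equality total_rec_in_comp1[OF h] total_rec_in_comp1[OF idx]
        total_rec_in_hd)
  moreover have "range h = {n. h (idx (m n)) = n}"
  proof (intro equalityI subsetI)
    fix n assume "n \<in> range h"
    then obtain i where i: "n = h i" by blast
    have "P n (m n)" unfolding m_def by (rule LeastI_ex[OF ex_P])
    then obtain k where k: "m n = g k" and "n \<le> h k" by (auto simp: P_iff h_idx)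
    \<comment> \<open>Otherwise \<open>g k < g i\<close>, hence \<open>h k < h i = n\<close>,
      contrary to \<open>n \<le> h k\<close>.\<close>
    then have "g i \<le> m n" using less_iff[of k i] i by simp
    moreover have "m n \<le> g i" unfolding m_def by (rule Least_le) (simp add: P_iff h_idx i)
    ultimately show "n \<in> {n. h (idx (m n)) = n}" by (simp add: h_idx i)
  qed (auto intro: range_eqI sym)
  ultimately show ?thesis by simp
qed

text \<open>Listings are indexed from 1, so they become total after a shift of the index.\<close>

lemma listing_total_rec_in:
  assumes "listing h A"
  shows "total_rec_in G 1 (\<lambda>xs. h (Suc (hd xs)))"
proof -
  obtain f where f: "partrec_in {} 1 f" "\<And>n. n \<ge> 1 \<Longrightarrow> f [n] = Some (h n)"
    using assms unfolding listing_def computable_on_def by auto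
  have "partrec_in {} 1 (pf_comp f [\<lambda>xs. Some (Suc (hd xs))])"
    using f(1) partrec_in.succ[of "{}"] by (intro partrec_in.comp) auto
  then have "total_rec_in {} 1 (\<lambda>xs. h (Suc (hd xs)))"
    unfolding total_rec_in_def by (intro exI conjI) (auto simp: pf_comp_def f(2))
  then show ?thesis by (rule total_rec_in_mono) simp
qed

lemma listing_range:
  assumes "listing h A"
  shows "range (\<lambda>i. h (Suc i)) = A"
proof -
  have "A = h ` {1..}" using assms by (simp add: listing_def bij_betw_def)
  also have "{1..} = range Suc" by (auto simp: image_iff Suc_le_eq gr0_conv_Suc)
  finally show ?thesis by (simp add: image_image)
qed

lemma uniform_decidable_in:
  assumes "uniform A B" and "decidable_in G B"
  shows "decidable_in G A"
proof -
  obtain h g where hg: "listing h A" "listing g B" "uniform_listings h g"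
    using assms(1) by (auto simp: uniform_def)
  have "decidable_in G (range (\<lambda>i. h (Suc i)))"
  proof (rule decidable_in_range_uniform)
    show "h (Suc i) < h (Suc j) \<longleftrightarrow> g (Suc i) < g (Suc j)" for i j
      using hg(3) by (auto simp: uniform_listings_def)
    show "infinite (range (\<lambda>i. h (Suc i)))"
      unfolding listing_range[OF hg(1)]
      using hg(1) by (simp add: listing_def infinite_re_def)
    show "decidable_in G (range (\<lambda>i. g (Suc i)))"
      unfolding listing_range[OF hg(2)] by (rule assms(2))
  qed (rule listing_total_rec_in[OF hg(1)] listing_total_rec_in[OF hg(2)])+
  then show ?thesis by (simp only: listing_range[OF hg(1)])
qed

section \<open>Type-2 uniformity and Turing reducibility\<close>

lemma uniform_sym: "uniform A B \<Longrightarrow> uniform B A"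
  unfolding uniform_def uniform_listings_def by blast

lemma type2_uniform_sym: "type2_uniform A B \<Longrightarrow> type2_uniform B A"
  unfolding type2_uniform_def using uniform_sym by blast

text \<open>Relative to the oracle for \<open>B\<close>, decidability passes from \<open>B\<close>
  to \<open>B'\<close> by finite change, to \<open>A'\<close> by uniformity and to \<open>A\<close>
  by finite change again.\<close>

lemma type2_uniform_turing_le:
  assumes "type2_uniform A B"
  shows "A \<le>\<^sub>T B"
  using assms turing_le_refl[of B] unfolding type2_uniform_def turing_le_iff
  by (meson almost_equal_sym decidable_in_almost_equal uniform_decidable_in)

theorem theorem4p11:
  fixes A B :: "nat set"
  assumes "infinite_re A" and "infinite_re B"
    and "type2_uniform A B"
  shows "A \<equiv>\<^sub>T B"
  using assms(3) type2_uniform_sym type2_uniform_turing_le unfolding turing_equiv_def by blast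

end
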